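(* Let $B=\{b_{ij}\}_{i,j=1}^{k}$ with $b_{ij}=(d(q_j,p_i)-\frac{\pi}{2})^2$. If $\mathrm{rank}(B)=k$, then for every $\alpha\in P_m^+$ the function $f\mapsto H_{lik}(f;\alpha)$ is convex on $D$.
   Context: $\mathrm{Sym}_2^+$ is the set of real symmetric positive definite $2\times 2$ matrices. For a positive integer $N$, $P_N^+=\{x\in\mathbb{R}^N: x_i\ge 0,\ \sum_i x_i=1\}$. Fix points $p_1,\dots,p_k$ (distribution domain) and $q_1,\dots,q_k$ (observation points) on the unit sphere $\mathbb{S}^2\subset\mathbb{R}^3$, with $p_i\ne \pm q_j$ for all $i,j$, and let $d(q,p)=\cos^{-1}\langle q,p\rangle$ be the spherical distance. Let $\overrightarrow{q_jp_i}=\frac{\cos^{-1}\langle p_i,q_j\rangle}{(1-\langle p_i,q_j\rangle^2)^{1/2}}\,(p_i-\langle p_i,q_j\rangle q_j)$, a vector of the tangent plane to $\mathbb{S}^2$ at $q_j$; fix a basis of each such tangent plane and regard $\overrightarrow{q_jp_i}$ as a column vector in $\mathbb{R}^2$. The norm $\|\overrightarrow{q_jp_i}\|=d(q_j,p_i)$ is the Riemannian norm. For $f\in P_k^+$ put $$\Sigma[f]_j=\sum_{i=1}^k \overrightarrow{q_jp_i}\,(\overrightarrow{q_jp_i})'\Big(1-\frac{\pi}{2\|\overrightarrow{q_jp_i}\|}\Big)^2 f_i,\qquad j=1,\dots,k,$$ where $'$ denotes transpose. Let $D=\{f\in P_k^+ : \Sigma[f]_j\in \mathrm{Sym}_2^+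 \text{ for all } j\}$ (a convex set). Fix $f^1,\dots,f^m\in D$, put $C_j^s=\Sigma[f^s]_j$, and for $f\in D$, $\alpha\in P_m^+$ define $$H_{lik}(f;\alpha)=\sum_{s=1}^m\alpha_s\sum_{j=1}^k\Big\{\mathrm{tr}\big(\Sigma[f]_j(C_j^s)^{-1}\big)-\ln\big|\Sigma[f]_j(C_j^s)^{-1}\big|-2\Big\},$$ where $|\cdot|$ is the determinant. *)

theory Defs
  imports "HOL-Analysis.Analysis"
begin

text \<open>
  Points are families \<open>p q :: 'k \<Rightarrow> real^3\<close> over a finite index type, so the number of
  points is \<open>CARD('k)\<close>. The parameter \<open>e j :: real^3^2\<close> lists the two vectors of the
  chosen (not necessarily orthonormal) basis of the tangent plane at \<open>q j\<close>.
\<close>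

definition spd :: "(real^'n^'n) set" where
  "spd = {A. transpose A = A \<and> (\<forall>x. x \<noteq> 0 \<longrightarrow> 0 < x \<bullet> (A *v x))}"

definition prob_simplex :: "(real^'n) set" where
  "prob_simplex = {x. (\<forall>i. 0 \<le> x $ i) \<and> (\<Sum>i\<in>UNIV. x $ i) = 1}"

definition sph_dist :: "real^3 \<Rightarrow> real^3 \<Rightarrow> real" where
  "sph_dist q p = arccos (q \<bullet> p)"

definition tangent_plane :: "real^3 \<Rightarrow> (real^3) set" where
  "tangent_plane q = {v. q \<bullet> v = 0}"

definition is_basis_of :: "real^3^2 \<Rightarrow> (real^3) set \<Rightarrow> bool" where
  "is_basis_of b T \<longleftrightarrow> inj (($) b) \<and> independent (range (($) b)) \<and> span (range (($) b)) = T"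

definition coords :: "real^3^2 \<Rightarrow> real^3 \<Rightarrow> real^2" where
  "coords b v = (\<chi> l. representation (range (($) b)) v (b $ l))"

definition log_vec :: "real^3 \<Rightarrow> real^3 \<Rightarrow> real^3" where
  "log_vec q p = (arccos (p \<bullet> q) / sqrt (1 - (p \<bullet> q)\<^sup>2)) *\<^sub>R (p - (p \<bullet> q) *\<^sub>R q)"

definition outer_square :: "real^'n \<Rightarrow> real^'n^'n" where
  "outer_square v = (columnvector v :: real^1^'n) ** (rowvector v :: real^'n^1)"

text \<open>
  The norm below is the Riemannian one, i.e. the ambient Euclidean norm of the tangent vector,
  and not the norm of its coordinate column, which depends on the chosen basis.
\<close>

definition Sigma_field ::
  "('k::finite \<Rightarrow> real^3) \<Rightarrow> ('k \<Rightarrow> real^3) \<Rightarrow> ('k \<Rightarrow> real^3^2) \<Rightarrow> real^'k \<Rightarrow> 'k \<Rightarrow> real^2^2" where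
  "Sigma_field p q e f j =
     (\<Sum>i\<in>UNIV. ((1 - pi / (2 * norm (log_vec (q j) (p i))))\<^sup>2 * f $ i) *\<^sub>R
                  outer_square (coords (e j) (log_vec (q j) (p i))))"

definition D_set ::
  "('k::finite \<Rightarrow> real^3) \<Rightarrow> ('k \<Rightarrow> real^3) \<Rightarrow> ('k \<Rightarrow> real^3^2) \<Rightarrow> (real^'k) set" where
  "D_set p q e = {f \<in> prob_simplex. \<forall>j. Sigma_field p q e f j \<in> spd}"

definition H_lik ::
  "('k::finite \<Rightarrow> real^3) \<Rightarrow> ('k \<Rightarrow> real^3) \<Rightarrow> ('k \<Rightarrow> real^3^2) \<Rightarrow> ('m::finite \<Rightarrow> real^'k) \<Rightarrow>
    real^'k \<Rightarrow> real^'m \<Rightarrow> real" where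
  "H_lik p q e fs f \<alpha> =
     (\<Sum>s\<in>UNIV. \<alpha> $ s * (\<Sum>j\<in>UNIV.
        let M = Sigma_field p q e f j ** matrix_inv (Sigma_field p q e (fs s) j)
        in trace M - ln (det M) - 2))"

definition B_mat :: "('k::finite \<Rightarrow> real^3) \<Rightarrow> ('k \<Rightarrow> real^3) \<Rightarrow> real^'k^'k" where
  "B_mat p q = (\<chi> i j. (sph_dist (q j) (p i) - pi / 2)\<^sup>2)"

end

theory Submission
  imports Defs
begin

text \<open>
  \<open>\<Sigma>[f]\<^sub>j\<close> is linear in \<open>f\<close>, so the trace term of \<open>H\<^sub>l\<^sub>i\<^sub>k\<close> is linear and everything rests on
  the concavity of \<open>ln \<circ> det\<close> on positive definite \<open>2 \<times> 2\<close> matrices. There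
  \<open>det (x A + B)\<close> is a quadratic polynomial in \<open>x\<close> that is nonpositive where the first
  diagonal entry of \<open>x A + B\<close> vanishes. Its discriminant is therefore nonnegative, which is
  Minkowski's inequality \<open>sqrt (det (A + B)) \<ge> sqrt (det A) + sqrt (det B)\<close>, and \<open>ln\<close> is
  increasing and concave.
\<close>

lemma linear_quadratic_form:
  "linear (\<lambda>A :: real^'n^'n. x \<bullet> (A *v x))"
  by (rule linearI)
    (simp_all only: matrix_vector_mult_add_rdistrib inner_add_right inner_scaleR_right
      scaleR_matrix_vector_assoc[symmetric] real_scaleR_def)

lemma convex_spd: "convex (spd :: (real^'n^'n) set)"
proof (rule convexI)
  fix A B :: "real^'n^'n" and u v :: real
  assume A: "A \<in> spd" and B: "B \<in> spd" and uv: "0 \<le> u" "0 \<le> v" "u + v = 1"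
  have "0 < x \<bullet> ((u *\<^sub>R A + v *\<^sub>R B) *v x)" if "x \<noteq> 0" for x
  proof -
    have "0 < x \<bullet> (A *v x)" "0 < x \<bullet> (B *v x)"
      using A B that by (auto simp: spd_def)
    \<comment> \<open>One of the weights may vanish. If \<open>u = 0\<close> then
      \<open>v = 1\<close> and the second summand is strictly positive; otherwise the first one
      is.\<close>
    hence "0 < u * (x \<bullet> (A *v x)) + v * (x \<bullet> (B *v x))"
      using uv by (cases "u = 0") (auto intro: add_pos_nonneg)
    thus ?thesis
      using linear_add[OF linear_quadratic_form[of x]] linear_scale[OF linear_quadratic_form[of x]]
      by simp
  qed
  moreover have "transpose (u *\<^sub>R A + v *\<^sub>R B) = u *\<^sub>R A + v *\<^sub>R B"
    using A B by (simp add: spd_def transpose_def vec_eq_iff)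
  ultimately show "u *\<^sub>R A + v *\<^sub>R B \<in> spd"
    by (simp add: spd_def)
qed

lemma spd_2:
  fixes A :: "real^2^2"
  assumes "A \<in> spd"
  shows "A $ 2 $ 1 = A $ 1 $ 2" "0 < A $ 1 $ 1" "0 < det A"
proof -
  have "transpose A $ 1 $ 2 = A $ 1 $ 2"
    using assms by (simp add: spd_def)
  thus sym: "A $ 2 $ 1 = A $ 1 $ 2"
    by (simp add: transpose_def)
  have pos: "0 < x \<bullet> (A *v x)" if "x \<noteq> 0" for x
    using assms that by (auto simp: spd_def)
  show a: "0 < A $ 1 $ 1"
    using pos[of "vector [1, 0]"]
    by (simp add: inner_vec_def matrix_vector_mult_def sum_2 vec_eq_iff forall_2)
  \<comment> \<open>The witness is the second column of the adjugate: \<open>A\<close> sends it to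
    (0, det A), so the quadratic form there is the first diagonal entry times the
    determinant.\<close>
  have "0 < vector [- A $ 1 $ 2, A $ 1 $ 1] \<bullet> (A *v vector [- A $ 1 $ 2, A $ 1 $ 1])"
    using a by (intro pos) (simp add: vec_eq_iff forall_2)
  also have "\<dots> = A $ 1 $ 1 * det A"
    using sym by (simp add: inner_vec_def matrix_vector_mult_def sum_2 det_2 algebra_simps)
  finally show "0 < det A"
    using a by (simp add: zero_less_mult_iff)
qed

text \<open>With \<open>a, b, c\<close> and \<open>a', b', c'\<close> as entries of A and B, the
  right-hand side m is the coefficient of x in det (x A + B). The discriminant only bounds m^2 from
  below, so the sign of m is settled separately before taking roots.\<close>

lemma mixed_discriminant_ge:
  fixes a b c a' b' c' :: real
  assumes a: "0 < a" "0 < a * c - b\<^sup>2" and a': "0 < a'" "0 < a' * c' - b'\<^sup>2"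
  shows "2 * sqrt ((a * c - b\<^sup>2) * (a' * c' - b'\<^sup>2)) \<le> a * c' + a' * c - 2 * b * b'"
proof -
  define m where "m = a * c' + a' * c - 2 * b * b'"
  have "a * a' * m = a\<^sup>2 * (a' * c' - b'\<^sup>2) + a'\<^sup>2 * (a * c - b\<^sup>2) + (a * b' - a' * b)\<^sup>2"
    by (simp add: m_def power2_eq_square algebra_simps)
  hence "0 \<le> a * a' * m"
    using a a' by simp
  hence m: "0 \<le> m"
    using mult_pos_pos[OF a(1) a'(1)] by (simp add: zero_le_mult_iff)
  \<comment> \<open>For P(x) = det (x A + B), completing the square gives discriminant = (2 x det A
    + m)^2 - 4 det A P(x). At x = -a'/a the first diagonal entry vanishes and P(x) = -(x b + b')^2;
    multiplying by a^2 clears denominators.\<close>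
  have "a\<^sup>2 * (m\<^sup>2 - 4 * (a * c - b\<^sup>2) * (a' * c' - b'\<^sup>2))
      = (a * m - 2 * (a * c - b\<^sup>2) * a')\<^sup>2 + 4 * (a * c - b\<^sup>2) * (a * b' - a' * b)\<^sup>2"
    by (simp add: m_def power2_eq_square algebra_simps)
  also have "\<dots> \<ge> 0"
    using a by simp
  finally have "4 * ((a * c - b\<^sup>2) * (a' * c' - b'\<^sup>2)) \<le> m\<^sup>2"
    using a(1) by (simp add: zero_le_mult_iff mult.assoc del: right_diff_distrib_numeral)
  from real_sqrt_le_mono[OF this] m show ?thesis
    by (simp add: real_sqrt_mult m_def)
qed

text \<open>After squaring, both sides share the terms u^2 det A and v^2 det B, so only the cross
  terms remain to be compared, which is \<open>mixed_discriminant_ge\<close>.\<close>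

lemma sqrt_det_superadditive:
  fixes A B :: "real^2^2"
  assumes A: "A \<in> spd" and B: "B \<in> spd" and uv: "0 \<le> u" "0 \<le> v"
  shows "u * sqrt (det A) + v * sqrt (det B) \<le> sqrt (det (u *\<^sub>R A + v *\<^sub>R B))"
proof (rule real_le_rsqrt)
  note sA = spd_2[OF A] and sB = spd_2[OF B]
  define m where "m = A$1$1 * B$2$2 + B$1$1 * A$2$2 - 2 * A$1$2 * B$1$2"
  have d: "det A = A$1$1 * A$2$2 - (A$1$2)\<^sup>2" "det B = B$1$1 * B$2$2 - (B$1$2)\<^sup>2"
    using sA(1) sB(1) by (simp_all add: det_2 power2_eq_square)
  have "2 * (sqrt (det A) * sqrt (det B)) \<le> m"
    using mixed_discriminant_ge[of "A$1$1" "A$2$2" "A$1$2" "B$1$1" "B$2$2" "B$1$2"] sA sB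
    by (simp add: d m_def real_sqrt_mult)
  hence "u * v * (2 * (sqrt (det A) * sqrt (det B))) \<le> u * v * m"
    using uv by (intro mult_left_mono) auto
  hence "(u * sqrt (det A) + v * sqrt (det B))\<^sup>2 \<le> u\<^sup>2 * det A + v\<^sup>2 * det B + u * v * m"
    using sA(3) sB(3) by (simp add: power2_sum power_mult_distrib mult_ac)
  also have "\<dots> = det (u *\<^sub>R A + v *\<^sub>R B)"
    using sA(1) sB(1) by (simp add: det_2 m_def power2_eq_square algebra_simps)
  finally show "(u * sqrt (det A) + v * sqrt (det B))\<^sup>2 \<le> det (u *\<^sub>R A + v *\<^sub>R B)" .
qed

lemma concave_on_ln_det: "concave_on (spd :: (real^2^2) set) (\<lambda>A. ln (det A))"
  unfolding concave_on_iff
proof (intro conjI convex_spd ballI allI impI)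
  fix A B :: "real^2^2" and u v :: real
  assume A: "A \<in> spd" and B: "B \<in> spd" and uv: "0 \<le> u" "0 \<le> v" "u + v = 1"
  have pos: "0 < det A" "0 < det B" "0 < det (u *\<^sub>R A + v *\<^sub>R B)"
    using A B uv by (blast intro: spd_2(3) convexD[OF convex_spd])+
  have "concave_on {0<..} (ln :: real \<Rightarrow> real)"
    by (rule ln_concave)
  \<comment> \<open>The detour through square roots costs only a common factor 1/2, which
    \<open>ln_sqrt\<close> cancels at the end.\<close>
  hence "u * ln (sqrt (det A)) + v * ln (sqrt (det B)) \<le> ln (u * sqrt (det A) + v * sqrt (det B))"
    using uv pos unfolding concave_on_iff real_scaleR_def by simp
  also have "\<dots> \<le> ln (sqrt (det (u *\<^sub>R A + v *\<^sub>R B)))"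
  proof (subst ln_le_cancel_iff)
    show "0 < u * sqrt (det A) + v * sqrt (det B)"
      using uv pos by (cases "u = 0") (auto intro: add_pos_nonneg)
  qed (use sqrt_det_superadditive[OF A B uv(1,2)] pos in auto)
  finally show "u * ln (det A) + v * ln (det B) \<le> ln (det (u *\<^sub>R A + v *\<^sub>R B))"
    using pos by (simp add: ln_sqrt)
qed

lemma convex_on_cong:
  assumes "convex_on S f" "\<And>x. x \<in> S \<Longrightarrow> f x = g x"
  shows "convex_on S g"
proof -
  have "convex S"
    using assms(1) by (rule convex_on_imp_convex)
  from convexD[OF this] assms show ?thesis
    by (simp add: convex_on_def)
qed

lemma convex_on_linear_vimage:
  assumes "linear g" "convex_on S f"
  shows "convex_on (g -` S) (\<lambda>x. f (g x))"
  using assms convex_linear_vimage[of g S]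
  by (auto simp: convex_on_def linear_add linear_scale)

lemma linear_convex_on:
  assumes "linear (g :: 'a::real_vector \<Rightarrow> real)" "convex S"
  shows "convex_on S g"
  using assms by (auto simp: convex_on_def linear_add linear_scale)

lemma convex_on_sum_fun:
  assumes "convex S" "\<And>i. i \<in> I \<Longrightarrow> convex_on S (f i)"
  shows "convex_on S (\<lambda>x. \<Sum>i\<in>I. f i x)"
  using assms
  by (induction I rule: infinite_finite_induct) (simp_all add: convex_on_const convex_on_add)

lemma linear_trace_mult_right: "linear (\<lambda>A :: real^'n^'n. trace (A ** K))"
  by (rule linearI)
    (simp_all add: trace_def matrix_matrix_mult_def sum.distrib algebra_simps sum_distrib_left)

lemma linear_Sigma_field: "linear (\<lambda>f. Sigma_field p q e f j)"
  by (rule linearI)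
    (simp_all add: Sigma_field_def algebra_simps sum.distrib scaleR_sum_right)

lemma convex_prob_simplex: "convex (prob_simplex :: (real^'n) set)"
  by (rule convexI) (simp add: prob_simplex_def sum.distrib flip: sum_distrib_left)

lemma convex_D_set: "convex (D_set p q e)"
proof -
  have "D_set p q e = prob_simplex \<inter> (\<Inter>j. (\<lambda>f. Sigma_field p q e f j) -` spd)"
    by (auto simp: D_set_def)
  thus ?thesis
    by (simp add: convex_Int convex_INT convex_prob_simplex convex_linear_vimage
        linear_Sigma_field convex_spd)
qed

text \<open>The product with the inverse of \<open>C\<close> need not be symmetric, so concavity of
  \<open>ln \<circ> det\<close> is applied to \<open>A\<close> alone; the inverse contributes an
  additive constant through multiplicativity of the determinant.\<close>

lemma convex_on_trace_minus_ln_det: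
  fixes C :: "real^2^2"
  assumes "C \<in> spd"
  shows "convex_on spd (\<lambda>A. trace (A ** matrix_inv C) - ln (det (A ** matrix_inv C)) - 2)"
proof -
  define K where "K = matrix_inv C"
  have "invertible C"
    using spd_2(3)[OF assms] by (simp add: invertible_det_nz)
  \<comment> \<open>\<open>matrix_inv\<close> is defined by choice, so its inverse property is
    extracted from invertibility.\<close>
  hence "det C * det K = 1"
    unfolding K_def invertible_def matrix_inv_def
    by (metis (mono_tags, lifting) det_I det_mul someI_ex)
  hence K: "0 < det K"
    using spd_2(3)[OF assms] by (metis zero_less_mult_pos zero_less_one)
  have "convex_on spd (\<lambda>A. trace (A ** K) + - ln (det A) + (- ln (det K) - 2))"
    using concave_on_ln_det linear_convex_on[OF linear_trace_mult_right convex_spd]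
    by (intro convex_on_add) (auto simp: concave_on_def convex_on_const convex_spd)
  \<comment> \<open>The logarithm is split using det A > 0, hence an identity on \<open>spd\<close>
    and transfer by \<open>convex_on_cong\<close>.\<close>
  moreover have "trace (A ** K) + - ln (det A) + (- ln (det K) - 2)
      = trace (A ** K) - ln (det (A ** K)) - 2" if "A \<in> spd" for A
    using K spd_2(3)[OF that] by (simp add: det_mul ln_mult_pos)
  ultimately show ?thesis
    unfolding K_def[symmetric] by (rule convex_on_cong)
qed

theorem proposition3:
  fixes p q :: "'k::finite \<Rightarrow> real^3"
    and e :: "'k \<Rightarrow> real^3^2"
    and fs :: "'m::finite \<Rightarrow> real^'k"
  assumes "\<And>i. p i \<in> sphere 0 1"
    and "\<And>j. q j \<in> sphere 0 1"
    and "\<And>i j. p i \<noteq> q j \<and> p i \<noteq> - q j"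
    and "\<And>j. is_basis_of (e j) (tangent_plane (q j))"
    and "\<And>s. fs s \<in> D_set p q e"
    and "rank (B_mat p q) = CARD('k)"
  shows "\<forall>\<alpha> \<in> prob_simplex. convex_on (D_set p q e) (\<lambda>f. H_lik p q e fs f \<alpha>)"
proof
  fix \<alpha> :: "real^'m"
  assume \<alpha>: "\<alpha> \<in> prob_simplex"
  let ?M = "\<lambda>f s j. Sigma_field p q e f j ** matrix_inv (Sigma_field p q e (fs s) j)"
  have H_term: "convex_on (D_set p q e) (\<lambda>f. trace (?M f s j) - ln (det (?M f s j)) - 2)" for s j
  proof (rule convex_on_subset)
    \<comment> \<open>Convexity in \<open>A\<close> pulls back along the linear map from
      \<open>f\<close> to \<open>\<Sigma>[f]\<^sub>j\<close>, first on the whole preimage of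
      \<open>spd\<close>, which contains \<open>D_set p q e\<close>.\<close>
    have "Sigma_field p q e (fs s) j \<in> spd"
      using assms(5) by (simp add: D_set_def)
    from convex_on_linear_vimage[OF linear_Sigma_field convex_on_trace_minus_ln_det[OF this]]
    show "convex_on ((\<lambda>f. Sigma_field p q e f j) -` spd)
        (\<lambda>f. trace (?M f s j) - ln (det (?M f s j)) - 2)" .
  qed (auto simp: convex_D_set, simp add: D_set_def)
  show "convex_on (D_set p q e) (\<lambda>f. H_lik p q e fs f \<alpha>)"
    unfolding H_lik_def Let_def
    using \<alpha> by (intro convex_on_sum_fun convex_on_cmul H_term convex_D_set) (auto simp: prob_simplex_def)
qed

end
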